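(* Let $\mathbb{R}^n$ be endowed with a norm $\|\cdot\|$, let $\mathcal{C}\subseteq\mathbb{R}^n$ be a nonempty polytope, and let $f\colon\mathcal{C}\to\mathbb{R}$ be convex and differentiable in an open set containing $\mathcal{C}$. Suppose that $(\mathcal{C},f)$ satisfies a $(\mu,\theta)$-Hölderian error bound with respect to $\|\cdot\|$ for some $\mu>0$ and $\theta\in(0,1/2]$. Then $(\mathcal{C},f)$ satisfies a $(\tilde\mu,\theta)$-error bound relative to the vertex distance $\mathfrak{v}$ for $$\tilde\mu=\mu\cdot\Phi(F(X^* ),\mathcal{C})^{1/\theta}.$$
   Context: $f^*=\min_{\mathbf{x}\in\mathcal{C}}f(\mathbf{x})$ and $X^*=\{\mathbf{x}\in\mathcal{C}\mid f(\mathbf{x})=f^*\}$. $(\mu,\theta)$-Hölderian error bound with respect to $\|\cdot\|$: for all $\mathbf{x}\in\mathcal{C}$, $\left(\frac{f(\mathbf{x})-f^*}{\mu}\right)^\theta\ge\min_{\mathbf{x}^*\in X^*}\|\mathbf{x}^*-\mathbf{x}\|$. $(\mu,\theta)$-error bound relative to $\mathfrak{d}\colon\mathcal{C}\times\mathcal{C}\to[0,1]$: for all $\mathbf{x}\in\mathcal{C}$, $\left(\frac{f(\mathbf{x})-f^*}{\mu}\right)^\theta\ge\min_{\mathbf{x}^*\in X^*}\mathfrak{d}(\mathbf{x}^*,\mathbf{x})$. Vertex distance: let $\mathcal{V}$ be the vertex set of $\mathcal{C}$. For $\mathbf{x}\in\mathcal{C}$, $\mathbf{S}(\mathbf{x})$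 is the collection of all supports $S(\boldsymbol{\lambda})=\{\mathbf{v}\in\mathcal{V}\mid\lambda_{\mathbf{v}}>0\}$ over all $\boldsymbol{\lambda}\ge0$ with $\sum_{\mathbf{v}\in\mathcal{V}}\lambda_{\mathbf{v}}=1$ and $\mathbf{x}=\sum_{\mathbf{v}\in\mathcal{V}}\lambda_{\mathbf{v}}\mathbf{v}$. Then $\mathfrak{v}(\mathbf{y},\mathbf{x})=\max_{S\in\mathbf{S}(\mathbf{x})}\min\{\gamma\ge0\mid\mathbf{y}-\mathbf{x}=\gamma(\mathbf{v}-\mathbf{u})\text{ for some }\mathbf{v}\in\mathcal{C},\ \mathbf{u}\in\mathrm{conv}(S)\}$. $\mathrm{faces}(\mathcal{C})$ is the set of nonempty faces of $\mathcal{C}$ (including $\mathcal{C}$). For $\emptyset\ne X\subseteq\mathcal{C}$, $F(X)$ is the minimal face of $\mathcal{C}$ containing $X$. $\mathrm{dist}(F,G)=\min_{\mathbf{x}\in F,\mathbf{y}\in G}\|\mathbf{x}-\mathbf{y}\|$. Inner facial distance: for $F\in\mathrm{faces}(\mathcal{C})$, $\Phi(F,\mathcal{C})=\min\{\mathrm{dist}(G,\mathrm{conv}(\mathrm{vert}(\mathcal{C})\setminus G))\mid G\in\mathrm{faces}(F),\ G\subsetneq\mathcal{C}\}$, where $\mathrm{vert}(\mathcal{C})$ is the set of vertices of $\mathcal{C}$. *)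

theory Defs
  imports "HOL-Analysis.Analysis"
begin

text \<open>
  Each minimum of real numbers is rendered by the infimum, and the maximum in the vertex distance
  by the supremum. For a nonempty polytope and a function that is continuous on it, they are
  attained; the only index set that can be empty is that of the inner facial distance.
\<close>

text \<open>An arbitrary norm, in general different from the Euclidean norm of the type.\<close>

definition is_norm :: "('a::real_vector \<Rightarrow> real) \<Rightarrow> bool" where
  "is_norm N \<longleftrightarrow>
     (\<forall>x. 0 \<le> N x) \<and> (\<forall>x. N x = 0 \<longleftrightarrow> x = 0) \<and>
     (\<forall>a x. N (a *\<^sub>R x) = \<bar>a\<bar> * N x) \<and> (\<forall>x y. N (x + y) \<le> N x + N y)"

definition min_val :: "'a set \<Rightarrow> ('a \<Rightarrow> real) \<Rightarrow> real" where
  "min_val C f = (INF x\<in>C. f x)"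

definition argmins :: "'a set \<Rightarrow> ('a \<Rightarrow> real) \<Rightarrow> 'a set" where
  "argmins C f = {x \<in> C. f x = min_val C f}"

definition holder_error_bound ::
  "('a::real_vector \<Rightarrow> real) \<Rightarrow> real \<Rightarrow> real \<Rightarrow> 'a set \<Rightarrow> ('a \<Rightarrow> real) \<Rightarrow> bool" where
  "holder_error_bound N \<mu> \<theta> C f \<longleftrightarrow>
     (\<forall>x\<in>C. ((f x - min_val C f) / \<mu>) powr \<theta> \<ge> (INF y\<in>argmins C f. N (y - x)))"

text \<open>The first conjunct expresses that \<open>d\<close> is a map from \<open>C \<times> C\<close> to the unit interval.\<close>

definition error_bound_relative ::
  "('a \<Rightarrow> 'a \<Rightarrow> real) \<Rightarrow> real \<Rightarrow> real \<Rightarrow> 'a set \<Rightarrow> ('a \<Rightarrow> real) \<Rightarrow> bool" where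
  "error_bound_relative d \<mu> \<theta> C f \<longleftrightarrow>
     (\<forall>y\<in>C. \<forall>x\<in>C. d y x \<in> {0..1}) \<and>
     (\<forall>x\<in>C. ((f x - min_val C f) / \<mu>) powr \<theta> \<ge> (INF y\<in>argmins C f. d y x))"

definition vertices :: "'a::real_vector set \<Rightarrow> 'a set" where
  "vertices C = {v. v extreme_point_of C}"

definition supports :: "'a::real_vector set \<Rightarrow> 'a \<Rightarrow> 'a set set" where
  "supports C x =
     {{v \<in> vertices C. l v > 0} | l :: 'a \<Rightarrow> real.
        (\<forall>v\<in>vertices C. 0 \<le> l v) \<and> (\<Sum>v\<in>vertices C. l v) = 1 \<and>
        x = (\<Sum>v\<in>vertices C. l v *\<^sub>R v)}"

definition vertex_distance :: "'a::real_vector set \<Rightarrow> 'a \<Rightarrow> 'a \<Rightarrow> real" where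
  "vertex_distance C y x =
     (SUP S\<in>supports C x.
        Inf {\<gamma>. 0 \<le> \<gamma> \<and> (\<exists>v\<in>C. \<exists>u\<in>convex hull S. y - x = \<gamma> *\<^sub>R (v - u))})"

definition faces :: "'a::real_vector set \<Rightarrow> 'a set set" where
  "faces C = {F. F face_of C \<and> F \<noteq> {}}"

definition min_face :: "'a::real_vector set \<Rightarrow> 'a set \<Rightarrow> 'a set" where
  "min_face C X = (\<lambda>F. F \<in> faces C) hull X"

definition set_dist ::
  "('a::real_vector \<Rightarrow> real) \<Rightarrow> 'a set \<Rightarrow> 'a set \<Rightarrow> real" where
  "set_dist N F G = (INF (x, y)\<in>F \<times> G. N (x - y))"

text \<open>
  If \<open>C\<close> is a single point, there is no proper nonempty face and the value below is the
  unspecified real number \<open>Inf {}\<close>.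
\<close>

definition inner_facial_distance ::
  "('a::real_vector \<Rightarrow> real) \<Rightarrow> 'a set \<Rightarrow> 'a set \<Rightarrow> real" where
  "inner_facial_distance N F C =
     (INF G\<in>{G \<in> faces F. G \<subset> C}. set_dist N G (convex hull (vertices C - G)))"

end

theory Submission
  imports Defs
begin

text \<open>
  Write \<open>F\<close> for the minimal face containing the minimizers and \<open>\<Phi>\<close> for the inner facial distance. The
  heart of the matter is the comparison \<open>vertex_distance C y x \<le> N (y - x) / \<Phi>\<close> for \<open>y \<in> F\<close> and
  \<open>x \<in> C\<close> (lemma \<open>vertex_distance_le\<close>). Once it is known, the Hoelder bound divided by \<open>\<Phi>\<close> is the
  claimed bound, because \<open>\<Phi> = (\<Phi> powr (1 / \<theta>)) powr \<theta>\<close>.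

  For the comparison, fix convex weights \<open>l\<close> of \<open>x\<close> on the vertices of \<open>C\<close>, and represent \<open>y\<close> by convex
  weights \<open>k\<close> on the vertices of \<open>F\<close>. Cancelling the common part \<open>min k l\<close>, of total mass \<open>m\<close>, leaves
  \<open>y - x = (1 - m) (v - u)\<close>, where \<open>v\<close> and \<open>u\<close> are the normalized residuals of \<open>k\<close> and \<open>l\<close>; moreover
  \<open>v \<in> F\<close>, and \<open>u\<close> lies in the convex hull of the support of \<open>l\<close>. So \<open>1 - m\<close> competes in the minimum
  that defines the vertex distance, which is thus at most \<open>1\<close>.

  Now let \<open>k\<close> maximize \<open>m\<close>, which is possible by compactness, and let \<open>G\<close> be the face of \<open>F\<close> that has
  \<open>v\<close> in its relative interior. No vertex \<open>w\<close> of \<open>G\<close> carries weight of \<open>u\<close>: the point \<open>v\<close> has a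
  representation on the vertices of \<open>G\<close> with positive weight at \<open>w\<close>, and replacing the residual of \<open>k\<close>
  by it would give \<open>y\<close> more mass in common with \<open>l\<close> (lemma \<open>residual_avoids_face\<close>). Hence \<open>u\<close> lies in
  the convex hull of the vertices outside \<open>G\<close>, so that \<open>N (v - u) \<ge> \<Phi>\<close> and
  \<open>N (y - x) \<ge> (1 - m) \<Phi>\<close>.

  The quotient by \<open>\<Phi>\<close> makes sense since \<open>\<Phi>\<close> is a minimum of finitely many distances of disjoint
  compact sets, unless \<open>C\<close> is a single point. There \<open>\<Phi>\<close> is unspecified, but the vertex distance
  vanishes.
\<close>

section \<open>Convex weights\<close>

text \<open>
  The weights are functions on the whole space that vanish outside \<open>V\<close>. This way the weights on the
  vertices of a face are also weights on all vertices of the polytope, and the sets of weights are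
  compact in the product topology.
\<close>

definition convex_weights :: "'a::real_vector set \<Rightarrow> 'a \<Rightarrow> ('a \<Rightarrow> real) set" where
  "convex_weights V y =
     {k. (\<forall>w. 0 \<le> k w) \<and> (\<forall>w. w \<notin> V \<longrightarrow> k w = 0) \<and> sum k V = 1 \<and>
         (\<Sum>w\<in>V. k w *\<^sub>R w) = y}"

lemma convex_weightsI:
  assumes "\<And>w. 0 \<le> k w" and "\<And>w. w \<notin> V \<Longrightarrow> k w = 0" and "sum k V = 1"
    and "(\<Sum>w\<in>V. k w *\<^sub>R w) = y"
  shows "k \<in> convex_weights V y"
  using assms by (simp add: convex_weights_def)

lemma convex_weightsD:
  assumes "k \<in> convex_weights V y"
  shows "0 \<le> k w" and "w \<notin> V \<Longrightarrow> k w = 0" and "sum k V = 1"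
    and "(\<Sum>w\<in>V. k w *\<^sub>R w) = y"
  using assms by (simp_all add: convex_weights_def)

lemma convex_weights_pos_imp_mem:
  assumes "k \<in> convex_weights V y" and "0 < k w"
  shows "w \<in> V"
  using assms convex_weightsD(2) by fastforce

lemma convex_weights_mono:
  assumes "finite V" and "A \<subseteq> V"
  shows "convex_weights A y \<subseteq> convex_weights V y"
proof
  fix k
  assume k: "k \<in> convex_weights A y"
  have "sum k V = sum k A" "(\<Sum>w\<in>V. k w *\<^sub>R w) = (\<Sum>w\<in>A. k w *\<^sub>R w)"
    using assms convex_weightsD(2)[OF k] by (intro sum.mono_neutral_right; auto)+
  then show "k \<in> convex_weights V y"
    using convex_weightsD[OF k] assms by (intro convex_weightsI) auto
qed

lemma convex_hull_iff_convex_weights: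
  assumes "finite V"
  shows "y \<in> convex hull V \<longleftrightarrow> convex_weights V y \<noteq> {}"
proof
  assume "y \<in> convex hull V"
  then obtain u where u: "\<forall>x\<in>V. 0 \<le> u x" "sum u V = 1" "(\<Sum>x\<in>V. u x *\<^sub>R x) = y"
    unfolding convex_hull_finite[OF assms] by blast
  then have "(\<lambda>w. if w \<in> V then u w else 0) \<in> convex_weights V y"
    by (intro convex_weightsI) (auto cong: sum.cong)
  then show "convex_weights V y \<noteq> {}"
    by blast
next
  assume "convex_weights V y \<noteq> {}"
  then show "y \<in> convex hull V"
    unfolding convex_hull_finite[OF assms] convex_weights_def by blast
qed

lemma weights_support_imp_convex_hull:
  assumes "finite V" and k: "k \<in> convex_weights V y" and "\<And>w. k w > 0 \<Longrightarrow> w \<in> A"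
  shows "y \<in> convex hull A"
proof -
  define B where "B = {w \<in> V. k w > 0}"
  have B: "B \<subseteq> V" "\<And>w. w \<notin> B \<Longrightarrow> k w = 0"
    using convex_weightsD(1,2)[OF k] by (auto simp: B_def less_le)
  have "sum k B = sum k V" "(\<Sum>w\<in>B. k w *\<^sub>R w) = (\<Sum>w\<in>V. k w *\<^sub>R w)"
    using assms(1) B by (intro sum.mono_neutral_left; auto)+
  then have "k \<in> convex_weights B y"
    using convex_weightsD[OF k] B by (intro convex_weightsI) auto
  moreover have "finite B"
    using assms(1) by (simp add: B_def)
  ultimately have "y \<in> convex hull B"
    using convex_hull_iff_convex_weights by blast
  moreover have "convex hull B \<subseteq> convex hull A"
    using assms(3) by (intro hull_mono) (auto simp: B_def)
  ultimately show ?thesis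
    by blast
qed

text \<open>
  The set is the closed part of a product of compact intervals that two continuous equations cut
  out.
\<close>

lemma compact_convex_weights:
  fixes V :: "'a::real_normed_vector set"
  assumes "finite V"
  shows "compact (convex_weights V y)"
proof -
  define I where "I = (\<lambda>w. if w \<in> V then {0..1::real} else {0})"
  have "compactin (product_topology (\<lambda>_::'a. euclidean::real topology) UNIV) (PiE UNIV I)"
    unfolding compactin_PiE by (auto simp: I_def)
  then have "compact (PiE UNIV I)"
    by (simp add: euclidean_product_topology)
  moreover have "closed {k. sum k V = 1 \<and> (\<Sum>w\<in>V. k w *\<^sub>R w) = y}"
    by (intro closed_Collect_conj closed_Collect_eq continuous_intros
        continuous_on_product_coordinates)
  ultimately have "compact (PiE UNIV I \<inter> {k. sum k V = 1 \<and> (\<Sum>w\<in>V. k w *\<^sub>R w) = y})"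
    by (rule compact_Int_closed)
  moreover have "convex_weights V y = PiE UNIV I \<inter> {k. sum k V = 1 \<and> (\<Sum>w\<in>V. k w *\<^sub>R w) = y}"
  proof -
    have "k w \<in> I w" if k: "k \<in> convex_weights V y" for k w
      using member_le_sum[of w V k] convex_weightsD[OF k] assms by (auto simp: I_def)
    moreover have "0 \<le> k w \<and> (w \<notin> V \<longrightarrow> k w = 0)" if "k \<in> PiE UNIV I" for k w
      using PiE_mem[OF that, of w] by (simp add: I_def split: if_splits)
    ultimately show ?thesis
      by (intro equalityI subsetI IntI PiE_I CollectI conjI convex_weightsI)
        (simp_all add: convex_weightsD)
  qed
  ultimately show ?thesis
    by simp
qed

section \<open>Cancelling the common mass of two systems of weights\<close>

definition overlap :: "'a set \<Rightarrow> ('a \<Rightarrow> real) \<Rightarrow> ('a \<Rightarrow> real) \<Rightarrow> real" where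
  "overlap V k l = (\<Sum>w\<in>V. min (k w) (l w))"

lemma overlap_nonneg:
  assumes "k \<in> convex_weights V y" and "l \<in> convex_weights V x"
  shows "0 \<le> overlap V k l"
  unfolding overlap_def
  using convex_weightsD(1)[OF assms(1)] convex_weightsD(1)[OF assms(2)]
  by (intro sum_nonneg) simp

lemma overlap_le_1:
  assumes "k \<in> convex_weights V y" and "l \<in> convex_weights V x"
  shows "overlap V k l \<le> 1"
  using sum_mono[of V "\<lambda>w. min (k w) (l w)" k] convex_weightsD(3)[OF assms(1)]
  by (simp add: overlap_def)

lemma overlap_commute: "overlap V k l = overlap V l k"
  by (simp add: overlap_def min.commute)

lemma ex_max_overlap:
  fixes A V :: "'a::real_normed_vector set"
  assumes "finite A" and "convex_weights A y \<noteq> {}"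
  obtains k where "k \<in> convex_weights A y"
    and "\<And>k'. k' \<in> convex_weights A y \<Longrightarrow> overlap V k' l \<le> overlap V k l"
proof -
  have "continuous_on (convex_weights A y) (\<lambda>k. overlap V k l)"
    unfolding overlap_def
    by (intro continuous_intros continuous_on_subset[OF continuous_on_product_coordinates]) auto
  then show ?thesis
    using continuous_attains_sup[OF compact_convex_weights[OF assms(1)] assms(2)] that by blast
qed

text \<open>
  The residual \<open>k - min k l\<close> has mass \<open>1 - overlap V k l\<close>, so after division by it the residual is
  again a system of convex weights.
\<close>

lemma residual_weights:
  assumes "k \<in> convex_weights V y" and "overlap V k l < 1" and "\<And>w. 0 \<le> l w"
  defines "r \<equiv> \<lambda>w. (k w - min (k w) (l w)) / (1 - overlap V k l)"
  shows "r \<in> convex_weights V (\<Sum>w\<in>V. r w *\<^sub>R w)"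
proof (rule convex_weightsI)
  show "sum r V = 1"
    using assms(2) convex_weightsD(3)[OF assms(1)]
    by (simp add: r_def overlap_def sum_subtractf flip: sum_divide_distrib)
qed (use assms convex_weightsD(2)[OF assms(1)] in \<open>auto simp: r_def\<close>)

lemma difference_of_residuals:
  fixes x y :: "'a::real_vector"
  assumes k: "k \<in> convex_weights V y" and l: "l \<in> convex_weights V x" and "overlap V k l < 1"
  shows "y - x = (1 - overlap V k l) *\<^sub>R
     ((\<Sum>w\<in>V. ((k w - min (k w) (l w)) / (1 - overlap V k l)) *\<^sub>R w) -
      (\<Sum>w\<in>V. ((l w - min (l w) (k w)) / (1 - overlap V k l)) *\<^sub>R w))"
proof -
  have "y - x = (\<Sum>w\<in>V. (k w - l w) *\<^sub>R w)"
    using convex_weightsD(4)[OF k] convex_weightsD(4)[OF l]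
    by (simp add: scaleR_left_diff_distrib sum_subtractf)
  also have "\<dots> = (\<Sum>w\<in>V. (k w - min (k w) (l w)) *\<^sub>R w - (l w - min (l w) (k w)) *\<^sub>R w)"
    by (intro sum.cong refl) (simp add: min.commute flip: scaleR_left_diff_distrib)
  finally show ?thesis
    using assms(3) by (simp add: scaleR_right_diff_distrib scaleR_sum_right sum_subtractf)
qed

lemma full_overlap_imp_eq:
  assumes k: "k \<in> convex_weights V y" and l: "l \<in> convex_weights V x" and "finite V"
    and "overlap V k l = 1"
  shows "y = x"
proof -
  have "(\<Sum>w\<in>V. k w - min (k w) (l w)) = 0" "(\<Sum>w\<in>V. l w - min (k w) (l w)) = 0"
    using assms(4) convex_weightsD(3)[OF k] convex_weightsD(3)[OF l]
    by (simp_all add: overlap_def sum_subtractf)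
  then have "k w - min (k w) (l w) = 0" "l w - min (k w) (l w) = 0" if "w \<in> V" for w
    using sum_nonneg_0[OF \<open>finite V\<close> _ _ that, of "\<lambda>w. k w - min (k w) (l w)"]
      sum_nonneg_0[OF \<open>finite V\<close> _ _ that, of "\<lambda>w. l w - min (k w) (l w)"]
    by simp_all
  then have "\<forall>w\<in>V. k w = l w"
    by (metis eq_iff_diff_eq_0)
  then show ?thesis
    using convex_weightsD(4)[OF k] convex_weightsD(4)[OF l] by (metis (no_types, lifting) sum.cong)
qed

section \<open>Vertices and faces of a polytope\<close>

lemma finite_vertices:
  fixes C :: "'a::euclidean_space set"
  assumes "polytope C"
  shows "finite (vertices C)"
  unfolding vertices_def
  by (rule finite_polyhedron_extreme_points[OF polytope_imp_polyhedron[OF assms]])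

lemma vertices_face:
  assumes "F face_of C"
  shows "vertices F = vertices C \<inter> F"
  using extreme_point_of_face[OF assms] by (auto simp: vertices_def)

lemma polytope_eq_hull_vertices:
  fixes C :: "'a::euclidean_space set"
  assumes "polytope C"
  shows "C = convex hull (vertices C)"
  unfolding vertices_def
  by (rule Krein_Milman_Minkowski[OF polytope_imp_compact[OF assms] polytope_imp_convex[OF assms]])

lemma mem_polytope_iff_convex_weights:
  fixes C :: "'a::euclidean_space set"
  assumes "polytope C"
  shows "y \<in> C \<longleftrightarrow> convex_weights (vertices C) y \<noteq> {}"
  using convex_hull_iff_convex_weights[OF finite_vertices[OF assms], of y]
    polytope_eq_hull_vertices[OF assms] by simp

text \<open>
  The smallest face containing \<open>v\<close> works: if \<open>v\<close> were on its relative boundary, then \<open>v\<close> would lie in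
  one of its facets, which is a smaller face.
\<close>

lemma ex_face_rel_interior:
  fixes S :: "'a::euclidean_space set"
  assumes "polytope S" and "v \<in> S"
  obtains G where "G face_of S" and "v \<in> rel_interior G"
proof -
  define G where "G = \<Inter>{H. H face_of S \<and> v \<in> H}"
  have "S face_of S"
    using assms(1) by (simp add: face_of_refl polytope_imp_convex)
  then have G: "G face_of S"
    unfolding G_def using assms(2) by (intro face_of_Inter) auto
  have vG: "v \<in> G"
    by (simp add: G_def)
  have polyG: "polytope G"
    using assms(1) G by (rule face_of_polytope_polytope)
  have "v \<in> rel_interior G"
  proof (rule ccontr)
    assume "v \<notin> rel_interior G"
    then have "v \<in> rel_frontier G"
      using vG closure_subset by (auto simp: rel_frontier_def)
    then obtain H where H: "H facet_of G" "v \<in> H"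
      using rel_frontier_of_polyhedron[OF polytope_imp_polyhedron[OF polyG]] by auto
    then have "H face_of S"
      using G face_of_trans facet_of_imp_face_of by blast
    then have "G \<subseteq> H"
      using H(2) by (auto simp: G_def)
    then have "H = G"
      using H(1) facet_of_imp_subset by blast
    then show False
      using H(1) by simp
  qed
  with G show ?thesis
    by (rule that)
qed

text \<open>
  From a relative interior point \<open>v\<close>, one can move a little away from \<open>w\<close> and stay in \<open>G\<close>. Then \<open>v\<close> is
  a proper convex combination of \<open>w\<close> and the point reached.
\<close>

lemma ex_weights_positive_at_vertex:
  fixes G :: "'a::euclidean_space set"
  assumes "polytope G" and v: "v \<in> rel_interior G" and w: "w \<in> vertices G"
  obtains r where "r \<in> convex_weights (vertices G) v" and "r w > 0"
proof -
  have fin: "finite (vertices G)"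
    by (rule finite_vertices[OF assms(1)])
  have "w \<in> G"
    using w by (simp add: vertices_def extreme_point_of_def)
  then obtain e where e: "e > 1" "(1 - e) *\<^sub>R w + e *\<^sub>R v \<in> G"
    using convex_rel_interior_iff[OF polytope_imp_convex[OF assms(1)]] v by blast
  then obtain s where s: "s \<in> convex_weights (vertices G) ((1 - e) *\<^sub>R w + e *\<^sub>R v)"
    using mem_polytope_iff_convex_weights[OF assms(1)] by blast
  define r where "r = (\<lambda>z. s z / e + (if z = w then 1 - 1 / e else 0))"
  have "(\<Sum>z\<in>vertices G. r z *\<^sub>R z)
      = (1 / e) *\<^sub>R (\<Sum>z\<in>vertices G. s z *\<^sub>R z) + (1 - 1 / e) *\<^sub>R w"
    using fin w
    by (simp add: r_def scaleR_add_left sum.distrib scaleR_sum_right if_distrib[of "\<lambda>c. c *\<^sub>R _"]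
        cong: if_cong)
  also have "\<dots> = v"
    unfolding convex_weightsD(4)[OF s] using e(1)
    by (simp add: scaleR_add_right diff_divide_distrib flip: scaleR_add_left)
  finally have "(\<Sum>z\<in>vertices G. r z *\<^sub>R z) = v" .
  moreover have "sum r (vertices G) = 1"
    using fin w convex_weightsD(3)[OF s]
    by (simp add: r_def sum.distrib flip: sum_divide_distrib)
  moreover have "0 \<le> r z" for z
    using e(1) convex_weightsD(1)[OF s] by (simp add: r_def)
  moreover have "r z = 0" if "z \<notin> vertices G" for z
    using w that convex_weightsD(2)[OF s] by (auto simp: r_def)
  ultimately have "r \<in> convex_weights (vertices G) v"
    by (intro convex_weightsI)
  moreover have "r w > 0"
    using e(1) convex_weightsD(1)[OF s, of w] by (simp add: r_def add_nonneg_pos)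
  ultimately show ?thesis
    by (rule that)
qed

section \<open>Representations with maximal overlap\<close>

text \<open>
  This is where maximality of the overlap enters. Let \<open>v\<close> be the normalized residual of \<open>k\<close>. If \<open>l\<close>
  exceeded \<open>k\<close> at a vertex \<open>w\<close> of \<open>G\<close>, then one could replace the residual of \<open>k\<close> by another
  representation of \<open>v\<close> that has mass at \<open>w\<close>. The new weights still represent \<open>y\<close> on the vertices of
  \<open>F\<close> and still dominate \<open>min k l\<close>, but they overlap more with \<open>l\<close> at \<open>w\<close>.
\<close>

lemma residual_avoids_face:
  fixes C :: "'a::euclidean_space set"
  assumes C: "polytope C" and F: "F face_of C" and G: "G face_of F"
    and k: "k \<in> convex_weights (vertices F) y"
    and max: "\<And>k'. k' \<in> convex_weights (vertices F) y \<Longrightarrow>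
      overlap (vertices C) k' l \<le> overlap (vertices C) k l"
    and l: "l \<in> convex_weights (vertices C) x"
    and lt1: "overlap (vertices C) k l < 1"
    and v: "(\<Sum>w\<in>vertices C. ((k w - min (k w) (l w)) / (1 - overlap (vertices C) k l)) *\<^sub>R w)
      \<in> rel_interior G" (is "?v \<in> _")
    and w: "w \<in> vertices C" "w \<in> G"
  shows "l w \<le> k w"
proof (rule ccontr)
  assume "\<not> l w \<le> k w"
  then have lw: "k w < l w"
    by simp
  let ?V = "vertices C"
  define g where "g = 1 - overlap ?V k l"
  have g: "g > 0"
    using lt1 by (simp add: g_def)
  have fin: "finite ?V"
    by (rule finite_vertices[OF C])
  have GC: "G face_of C"
    using G F by (rule face_of_trans)
  have FV: "vertices F \<subseteq> ?V" and GF: "vertices G \<subseteq> vertices F" and wG: "w \<in> vertices G"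
    using vertices_face[OF F] vertices_face[OF G] vertices_face[OF GC] w by auto
  have finF: "finite (vertices F)"
    using FV fin by (rule finite_subset)
  obtain r where "r \<in> convex_weights (vertices G) ?v" and rw: "r w > 0"
    using ex_weights_positive_at_vertex[OF face_of_polytope_polytope[OF C GC] v wG] by blast
  then have r: "r \<in> convex_weights (vertices F) ?v"
    using convex_weights_mono[OF finF GF] by blast
  have kV: "k \<in> convex_weights ?V y" and rV: "r \<in> convex_weights ?V ?v"
    using k r convex_weights_mono[OF fin FV] by blast+
  \<comment> \<open>\<open>k\<close> with its residual, of mass \<open>g\<close>, redistributed according to \<open>r\<close>\<close>
  define k' where "k' = (\<lambda>z. min (k z) (l z) + g * r z)"
  have nonneg: "0 \<le> k' z" for z
    using convex_weightsD(1)[OF k] convex_weightsD(1)[OF l] convex_weightsD(1)[OF r] g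
    by (simp add: k'_def)
  have zero: "k' z = 0" if "z \<notin> vertices F" for z
    using convex_weightsD(2)[OF k that] convex_weightsD(2)[OF r that] convex_weightsD(1)[OF l, of z]
    by (simp add: k'_def)
  have "sum k' ?V = 1"
    using convex_weightsD(3)[OF rV]
    by (simp add: k'_def sum.distrib overlap_def g_def flip: sum_distrib_left)
  then have one: "sum k' (vertices F) = 1"
    using sum.mono_neutral_right[OF fin FV, of k'] zero by auto
  have "(\<Sum>z\<in>?V. k' z *\<^sub>R z) = (\<Sum>z\<in>?V. min (k z) (l z) *\<^sub>R z) + g *\<^sub>R ?v"
    by (simp only: k'_def scaleR_add_left sum.distrib convex_weightsD(4)[OF rV, symmetric]
        scaleR_sum_right scaleR_scaleR)
  also have "\<dots> = (\<Sum>z\<in>?V. min (k z) (l z) *\<^sub>R z + (k z - min (k z) (l z)) *\<^sub>R z)"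
    using g by (simp add: scaleR_sum_right sum.distrib flip: g_def)
  also have "\<dots> = y"
    using convex_weightsD(4)[OF kV] by (simp flip: scaleR_add_left)
  finally have "(\<Sum>z\<in>?V. k' z *\<^sub>R z) = y" .
  then have "(\<Sum>z\<in>vertices F. k' z *\<^sub>R z) = y"
    using sum.mono_neutral_right[OF fin FV, of "\<lambda>z. k' z *\<^sub>R z"] zero by auto
  then have "k' \<in> convex_weights (vertices F) y"
    using nonneg zero one by (intro convex_weightsI)
  then have "overlap ?V k' l \<le> overlap ?V k l"
    by (rule max)
  moreover have "overlap ?V k l < overlap ?V k' l"
    unfolding overlap_def
  proof (rule sum_strict_mono_ex1[OF fin])
    show "\<forall>z\<in>?V. min (k z) (l z) \<le> min (k' z) (l z)"
      using g convex_weightsD(1)[OF r] by (auto simp: k'_def)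
    show "\<exists>z\<in>?V. min (k z) (l z) < min (k' z) (l z)"
    proof
      show "min (k w) (l w) < min (k' w) (l w)"
        using mult_pos_pos[OF g rw] lw unfolding k'_def by linarith
    qed (rule w)
  qed
  ultimately show False
    by simp
qed

text \<open>
  The factor \<open>g\<close> is the mass that is left when \<open>l\<close> and a maximally overlapping representation of \<open>y\<close> are
  cancelled against each other. The last conclusion makes the facial distance a lower bound of the
  norm of \<open>v - u\<close>.
\<close>

lemma connecting_segment:
  fixes C :: "'a::euclidean_space set"
  assumes C: "polytope C" and F: "F face_of C" and y: "y \<in> F"
    and l: "l \<in> convex_weights (vertices C) x"
  obtains g v u where "0 \<le> g" and "g \<le> 1" and "v \<in> C"
    and "u \<in> convex hull {w \<in> vertices C. l w > 0}" and "y - x = g *\<^sub>R (v - u)"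
    and "g > 0 \<Longrightarrow> \<exists>G\<in>faces F. G \<subset> C \<and> v \<in> G \<and> u \<in> convex hull (vertices C - G)"
proof -
  let ?V = "vertices C"
  have fin: "finite ?V"
    by (rule finite_vertices[OF C])
  have FV: "vertices F \<subseteq> ?V"
    using vertices_face[OF F] by auto
  have polyF: "polytope F"
    using C F by (rule face_of_polytope_polytope)
  have "convex_weights (vertices F) y \<noteq> {}"
    using mem_polytope_iff_convex_weights[OF polyF] y by blast
  then obtain k where k: "k \<in> convex_weights (vertices F) y"
    and max: "\<And>k'. k' \<in> convex_weights (vertices F) y \<Longrightarrow> overlap ?V k' l \<le> overlap ?V k l"
    using ex_max_overlap[OF finite_subset[OF FV fin]] by metis
  have kV: "k \<in> convex_weights ?V y"
    using k convex_weights_mono[OF fin FV] by blast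
  let ?g = "1 - overlap ?V k l"
  have bounds: "0 \<le> ?g" "?g \<le> 1"
    using overlap_le_1[OF kV l] overlap_nonneg[OF kV l] by simp_all
  show ?thesis
  proof (cases "?g = 0")
    case True
    then have "y - x = 0"
      using full_overlap_imp_eq[OF kV l fin] by simp
    moreover have "x \<in> convex hull {w \<in> ?V. l w > 0}"
      by (rule weights_support_imp_convex_hull[OF fin l])
        (simp add: convex_weights_pos_imp_mem[OF l])
    moreover have "y \<in> C"
      using y F face_of_imp_subset by blast
    ultimately show ?thesis
      by (intro that[of 0 y x]) simp_all
  next
    case False
    then have pos: "?g > 0"
      using bounds by simp
    then have lt1: "overlap ?V k l < 1" "overlap ?V l k < 1"
      by (simp_all add: overlap_commute)
    define p where "p = (\<lambda>w. (k w - min (k w) (l w)) / ?g)"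
    define q where "q = (\<lambda>w. (l w - min (l w) (k w)) / ?g)"
    define v where "v = (\<Sum>w\<in>?V. p w *\<^sub>R w)"
    define u where "u = (\<Sum>w\<in>?V. q w *\<^sub>R w)"
    have p: "p \<in> convex_weights ?V v"
      unfolding p_def v_def
      by (rule residual_weights[OF kV lt1(1) convex_weightsD(1)[OF l]])
    have q: "q \<in> convex_weights ?V u"
      unfolding q_def u_def
      using residual_weights[OF l lt1(2) convex_weightsD(1)[OF k]]
      by (simp add: overlap_commute)
    have diff: "y - x = ?g *\<^sub>R (v - u)"
      unfolding v_def u_def p_def q_def by (rule difference_of_residuals[OF kV l lt1(1)])
    have "w \<in> vertices F" if "p w > 0" for w
      using that convex_weightsD(2)[OF k, of w] convex_weightsD(1)[OF l, of w]
      by (cases "w \<in> vertices F") (simp_all add: p_def)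
    then have vF: "v \<in> F"
      using weights_support_imp_convex_hull[OF fin p] polytope_eq_hull_vertices[OF polyF] by blast
    have qpos: "w \<in> ?V \<and> l w > k w" if "q w > 0" for w
    proof
      show "w \<in> ?V"
        using q that by (rule convex_weights_pos_imp_mem)
      show "l w > k w"
        using that pos by (simp add: q_def zero_less_divide_iff min_def split: if_splits)
    qed
    have "u \<in> convex hull {w \<in> ?V. l w > 0}"
      by (rule weights_support_imp_convex_hull[OF fin q])
        (use qpos le_less_trans[OF convex_weightsD(1)[OF k]] in blast)
    moreover obtain G where G: "G face_of F" "v \<in> rel_interior G"
      using ex_face_rel_interior[OF polyF vF] by blast
    have avoid: "u \<in> convex hull (?V - G)"
    proof (rule weights_support_imp_convex_hull[OF fin q])
      fix w
      assume "q w > 0"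
      then show "w \<in> ?V - G"
        using residual_avoids_face[OF C F G(1) k max l lt1(1) G(2)[unfolded v_def p_def], of w]
          qpos[of w] by (meson DiffI not_le)
    qed
    have vG: "v \<in> G"
      using G(2) rel_interior_subset by blast
    have "G \<subseteq> C"
      using G(1) F face_of_imp_subset by blast
    \<comment> \<open>\<open>u\<close> lies in the hull of the vertices outside \<open>G\<close>, so there must be such vertices.\<close>
    moreover have "G \<noteq> C"
    proof
      assume "G = C"
      then have no_vertex: "?V - G = {}"
        by (auto simp: vertices_def extreme_point_of_def)
      show False
        using avoid unfolding no_vertex by simp
    qed
    moreover have "v \<in> C"
      using vG \<open>G \<subseteq> C\<close> by blast
    moreover have "G \<in> faces F"
      using G(1) vG by (auto simp: faces_def)
    ultimately show ?thesis
      using bounds diff avoid vG by (intro that[of ?g v u]) blast+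
  qed
qed

section \<open>Distances with respect to an arbitrary norm\<close>

lemma is_normD:
  assumes "is_norm N"
  shows "0 \<le> N x" and "N x = 0 \<longleftrightarrow> x = 0" and "N (a *\<^sub>R x) = \<bar>a\<bar> * N x"
    and "N (x + y) \<le> N x + N y"
  using assms by (simp_all add: is_norm_def)

lemma is_norm_continuous:
  fixes N :: "'a::euclidean_space \<Rightarrow> real"
  assumes "is_norm N"
  shows "continuous_on UNIV N"
proof (rule convex_on_continuous)
  show "convex_on UNIV N"
  proof (intro convex_onI)
    fix t :: real and x y :: 'a
    assume "0 < t" "t < 1"
    then show "N ((1 - t) *\<^sub>R x + t *\<^sub>R y) \<le> (1 - t) * N x + t * N y"
      using is_normD(4)[OF assms, of "(1 - t) *\<^sub>R x" "t *\<^sub>R y"] by (simp add: is_normD(3)[OF assms])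
  qed simp
qed simp

lemma set_dist_le:
  assumes "is_norm N" and "x \<in> A" and "y \<in> B"
  shows "set_dist N A B \<le> N (x - y)"
proof -
  have "bdd_below ((\<lambda>(x, y). N (x - y)) ` (A \<times> B))"
    using is_normD(1)[OF assms(1)] by (intro bdd_belowI[of _ 0]) auto
  from cINF_lower[OF this, of "(x, y)"] show ?thesis
    using assms(2,3) by (simp add: set_dist_def)
qed

lemma set_dist_pos:
  fixes N :: "'a::euclidean_space \<Rightarrow> real"
  assumes N: "is_norm N" and "compact A" and "compact B" and "A \<noteq> {}" and "B \<noteq> {}"
    and "A \<inter> B = {}"
  shows "0 < set_dist N A B"
proof -
  let ?N = "\<lambda>z. N (fst z - snd z)"
  have "continuous_on (A \<times> B) ?N"
    by (intro continuous_on_compose2[OF is_norm_continuous[OF N]] continuous_intros) auto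
  moreover have "compact (A \<times> B)" "A \<times> B \<noteq> {}"
    using assms(2-5) by (simp_all add: compact_Times)
  ultimately obtain z where z: "z \<in> A \<times> B" and min: "\<forall>z'\<in>A \<times> B. ?N z \<le> ?N z'"
    using continuous_attains_inf[of "A \<times> B" ?N] by blast
  have "fst z \<noteq> snd z"
    using z assms(6) by auto
  then have "0 < ?N z"
    using is_normD(1,2)[OF N, of "fst z - snd z"] by (simp add: less_le)
  also have "\<dots> \<le> set_dist N A B"
    unfolding set_dist_def case_prod_beta using min z by (intro cINF_greatest) blast+
  finally show ?thesis .
qed

section \<open>The inner facial distance\<close>

lemma finite_faces:
  fixes C :: "'a::euclidean_space set"
  assumes "polytope C"
  shows "finite (faces C)"
  by (rule finite_subset[OF _ finite_polytope_faces[OF assms]]) (auto simp: faces_def)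

lemma convex_diff_face:
  assumes "G face_of C" and "convex C"
  shows "convex (C - G)"
  unfolding convex_contains_segment
proof (intro ballI subsetI)
  fix a b z
  assume a: "a \<in> C - G" and b: "b \<in> C - G" and z: "z \<in> closed_segment a b"
  have "z \<in> C"
    using a b z assms(2) closed_segment_subset by blast
  moreover have "z \<notin> G"
  proof
    assume zG: "z \<in> G"
    then have "z \<in> open_segment a b"
      using a b z by (auto simp: open_segment_def)
    then show False
      using face_ofD[OF assms(1) _ _ _ zG] a b by blast
  qed
  ultimately show "z \<in> C - G"
    by blast
qed

text \<open>
  The complement of a face in a convex set is convex, so the hull of the vertices outside \<open>G\<close> does
  not meet \<open>G\<close>.
\<close>

lemma set_dist_face_pos:
  fixes N :: "'a::euclidean_space \<Rightarrow> real"
  assumes N: "is_norm N" and C: "polytope C" and G: "G face_of C" "G \<noteq> {}" "G \<noteq> C"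
  shows "0 < set_dist N G (convex hull (vertices C - G))"
proof (rule set_dist_pos[OF N])
  show "compact G"
    using face_of_polytope_polytope[OF C G(1)] by (rule polytope_imp_compact)
  show "compact (convex hull (vertices C - G))"
    using finite_vertices[OF C] by (simp add: finite_imp_compact_convex_hull)
  have "vertices C - G \<noteq> {}"
  proof
    assume "vertices C - G = {}"
    then have "convex hull (vertices C) \<subseteq> G"
      using face_of_imp_convex[OF G(1)] by (intro hull_minimal) auto
    then have "C \<subseteq> G"
      using polytope_eq_hull_vertices[OF C] by simp
    then show False
      using G(3) face_of_imp_subset[OF G(1)] by auto
  qed
  then show "convex hull (vertices C - G) \<noteq> {}"
    by simp
  have "convex hull (vertices C - G) \<subseteq> C - G"
  proof (rule hull_minimal)
    show "vertices C - G \<subseteq> C - G"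
      by (auto simp: vertices_def extreme_point_of_def)
    show "convex (C - G)"
      using G(1) polytope_imp_convex[OF C] by (rule convex_diff_face)
  qed
  then show "G \<inter> convex hull (vertices C - G) = {}"
    by blast
qed (rule G)

lemma inner_facial_distance_le:
  fixes N :: "'a::euclidean_space \<Rightarrow> real"
  assumes C: "polytope C" and F: "F face_of C" and G: "G \<in> faces F" "G \<subset> C"
  shows "inner_facial_distance N F C \<le> set_dist N G (convex hull (vertices C - G))"
  unfolding inner_facial_distance_def
  using finite_faces[OF face_of_polytope_polytope[OF C F]] G
  by (intro cINF_lower bdd_below_finite) auto

text \<open>
  If \<open>C\<close> is not a point, a vertex of \<open>F\<close> is a proper face of \<open>C\<close>. So the infimum runs over a finite
  nonempty family of positive numbers.
\<close>

lemma inner_facial_distance_pos: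
  fixes N :: "'a::euclidean_space \<Rightarrow> real"
  assumes N: "is_norm N" and C: "polytope C" and F: "F face_of C"
    and ne: "F \<noteq> {}" and nontriv: "\<And>c. C \<noteq> {c}"
  shows "0 < inner_facial_distance N F C"
proof -
  let ?D = "\<lambda>G. set_dist N G (convex hull (vertices C - G))"
  let ?P = "{G \<in> faces F. G \<subset> C}"
  have polyF: "polytope F"
    using C F by (rule face_of_polytope_polytope)
  have fin: "finite ?P"
    using finite_faces[OF polyF] by simp
  obtain w where w: "w extreme_point_of F"
    using polytope_eq_hull_vertices[OF polyF] ne by (force simp: vertices_def)
  then have "{w} \<in> ?P"
    using nontriv F face_of_imp_subset by (auto simp: faces_def face_of_singleton extreme_point_of_def)
  then have "(INF G\<in>?P. ?D G) \<in> ?D ` ?P"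
    using fin by (subst cInf_eq_Min) (auto intro: Min_in)
  then obtain G where G: "G \<in> ?P" "inner_facial_distance N F C = ?D G"
    unfolding inner_facial_distance_def by blast
  moreover have "0 < ?D G"
    using G(1) F by (intro set_dist_face_pos[OF N C]) (auto simp: faces_def intro: face_of_trans)
  ultimately show ?thesis
    by simp
qed

lemma min_face_face:
  assumes "convex C" and "X \<subseteq> C" and "X \<noteq> {}"
  shows "min_face C X face_of C"
proof -
  have "C \<in> {F. F \<in> faces C \<and> X \<subseteq> F}"
    using assms by (auto simp: faces_def face_of_refl)
  then show ?thesis
    unfolding min_face_def hull_def by (intro face_of_Inter) (auto simp: faces_def)
qed

section \<open>The vertex distance\<close>

lemma supports_eq:
  assumes "finite (vertices C)"
  shows "supports C x = (\<lambda>l. {w \<in> vertices C. l w > 0}) ` convex_weights (vertices C) x"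
proof (intro equalityI subsetI)
  fix S
  assume "S \<in> supports C x"
  then obtain l where l: "S = {w \<in> vertices C. l w > 0}" "\<forall>w\<in>vertices C. 0 \<le> l w"
    "(\<Sum>w\<in>vertices C. l w) = 1" "x = (\<Sum>w\<in>vertices C. l w *\<^sub>R w)"
    by (auto simp: supports_def)
  let ?l = "\<lambda>w. if w \<in> vertices C then l w else 0"
  have "?l \<in> convex_weights (vertices C) x"
    using l by (intro convex_weightsI) (auto cong: sum.cong)
  moreover have "S = {w \<in> vertices C. ?l w > 0}"
    using l(1) by auto
  ultimately show "S \<in> (\<lambda>l. {w \<in> vertices C. l w > 0}) ` convex_weights (vertices C) x"
    by (intro image_eqI)
qed (auto simp: supports_def convex_weights_def)

text \<open>The set whose infimum, for a support \<open>S\<close> of \<open>x\<close>, enters the vertex distance.\<close>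

definition segment_ratios :: "'a::real_vector set \<Rightarrow> 'a \<Rightarrow> 'a \<Rightarrow> 'a set \<Rightarrow> real set" where
  "segment_ratios C y x S =
     {g. 0 \<le> g \<and> (\<exists>v\<in>C. \<exists>u\<in>convex hull S. y - x = g *\<^sub>R (v - u))}"

lemma segment_ratio_bounds:
  fixes C :: "'a::euclidean_space set"
  assumes N: "is_norm N" and C: "polytope C" and F: "F face_of C" and y: "y \<in> F"
    and S: "S \<in> supports C x"
  obtains g where "g \<in> segment_ratios C y x S" and "g \<le> 1"
    and "g * inner_facial_distance N F C \<le> N (y - x)"
proof -
  obtain l where l: "l \<in> convex_weights (vertices C) x" and Sl: "S = {w \<in> vertices C. l w > 0}"
    using S unfolding supports_eq[OF finite_vertices[OF C]] by blast
  obtain g v u where gvu: "0 \<le> g" "g \<le> 1" "v \<in> C" "u \<in> convex hull S" "y - x = g *\<^sub>R (v - u)"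
    and ex: "g > 0 \<Longrightarrow> \<exists>G\<in>faces F. G \<subset> C \<and> v \<in> G \<and> u \<in> convex hull (vertices C - G)"
    unfolding Sl by (rule connecting_segment[OF C F y l]) blast
  have "g * inner_facial_distance N F C \<le> g * N (v - u)"
  proof (cases "g > 0")
    case True
    then obtain G where G: "G \<in> faces F" "G \<subset> C" "v \<in> G" "u \<in> convex hull (vertices C - G)"
      using ex by blast
    have "inner_facial_distance N F C \<le> N (v - u)"
      using inner_facial_distance_le[OF C F G(1,2)] set_dist_le[OF N G(3,4)] by (rule order_trans)
    then show ?thesis
      using True by simp
  next
    case False
    then show ?thesis
      using gvu(1) by simp
  qed
  also have "\<dots> = N (y - x)"
    using gvu(1,5) by (simp add: is_normD(3)[OF N])
  finally have "g * inner_facial_distance N F C \<le> N (y - x)" .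
  moreover have "g \<in> segment_ratios C y x S"
    using gvu by (auto simp: segment_ratios_def)
  ultimately show ?thesis
    using gvu(2) that by blast
qed

lemma Inf_segment_ratios:
  assumes "g \<in> segment_ratios C y x S"
  shows "0 \<le> Inf (segment_ratios C y x S)" and "Inf (segment_ratios C y x S) \<le> g"
proof -
  have ge: "0 \<le> g'" if "g' \<in> segment_ratios C y x S" for g'
    using that by (simp add: segment_ratios_def)
  show "0 \<le> Inf (segment_ratios C y x S)"
    using assms ge by (intro cInf_greatest) auto
  show "Inf (segment_ratios C y x S) \<le> g"
    using assms ge by (intro cInf_lower bdd_belowI[of _ 0])
qed

lemma supports_nonempty:
  fixes C :: "'a::euclidean_space set"
  assumes "polytope C" and "x \<in> C"
  shows "supports C x \<noteq> {}"
  using mem_polytope_iff_convex_weights[OF assms(1)] assms(2)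
  by (simp add: supports_eq[OF finite_vertices[OF assms(1)]])

lemma vertex_distance_eq:
  "vertex_distance C y x = (SUP S\<in>supports C x. Inf (segment_ratios C y x S))"
  by (simp add: vertex_distance_def segment_ratios_def)

lemma vertex_distance_bounds:
  fixes C :: "'a::euclidean_space set"
  assumes C: "polytope C" and "y \<in> C" and x: "x \<in> C"
  shows "vertex_distance C y x \<in> {0..1}"
proof -
  have CC: "C face_of C"
    using C by (simp add: face_of_refl polytope_imp_convex)
  \<comment> \<open>The bound by \<open>1\<close> comes with the comparison for any norm; the Euclidean norm is at hand.\<close>
  have norm: "is_norm (norm :: 'a \<Rightarrow> real)"
    by (simp add: is_norm_def norm_triangle_ineq)
  have le: "0 \<le> Inf (segment_ratios C y x S) \<and> Inf (segment_ratios C y x S) \<le> 1"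
    if S: "S \<in> supports C x" for S
  proof -
    obtain g where g: "g \<in> segment_ratios C y x S" "g \<le> 1"
      using segment_ratio_bounds[OF norm C CC assms(2) S] by blast
    show ?thesis
      using Inf_segment_ratios[OF g(1)] g(2) by linarith
  qed
  obtain S where S: "S \<in> supports C x"
    using supports_nonempty[OF C x] by blast
  have "Inf (segment_ratios C y x S) \<le> vertex_distance C y x"
    unfolding vertex_distance_eq using S le by (intro cSUP_upper bdd_aboveI[of _ 1]) auto
  moreover have "vertex_distance C y x \<le> 1"
    unfolding vertex_distance_eq using S le by (intro cSUP_least) auto
  ultimately show ?thesis
    using le[OF S] by simp
qed

lemma vertex_distance_le:
  fixes C :: "'a::euclidean_space set"
  assumes N: "is_norm N" and C: "polytope C" and F: "F face_of C" and y: "y \<in> F" and x: "x \<in> C"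
    and pos: "0 < inner_facial_distance N F C"
  shows "vertex_distance C y x \<le> N (y - x) / inner_facial_distance N F C"
  unfolding vertex_distance_eq
proof (rule cSUP_least[OF supports_nonempty[OF C x]])
  fix S
  assume S: "S \<in> supports C x"
  obtain g where g: "g \<in> segment_ratios C y x S" "g * inner_facial_distance N F C \<le> N (y - x)"
    using segment_ratio_bounds[OF N C F y S] by blast
  have "Inf (segment_ratios C y x S) \<le> g"
    by (rule Inf_segment_ratios[OF g(1)])
  also have "g \<le> N (y - x) / inner_facial_distance N F C"
    using g(2) pos by (simp add: pos_le_divide_eq)
  finally show "Inf (segment_ratios C y x S) \<le> N (y - x) / inner_facial_distance N F C" .
qed

lemma vertex_distance_self_le:
  fixes C :: "'a::euclidean_space set"
  assumes C: "polytope C" and x: "x \<in> C"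
  shows "vertex_distance C x x \<le> 0"
  unfolding vertex_distance_eq
proof (rule cSUP_least[OF supports_nonempty[OF C x]])
  fix S
  assume "S \<in> supports C x"
  then obtain l where l: "l \<in> convex_weights (vertices C) x" and S: "S = {w \<in> vertices C. l w > 0}"
    unfolding supports_eq[OF finite_vertices[OF C]] by blast
  have "w \<in> S" if "l w > 0" for w
    using that convex_weights_pos_imp_mem[OF l] S by simp
  then have "x \<in> convex hull S"
    by (rule weights_support_imp_convex_hull[OF finite_vertices[OF C] l])
  then have "0 \<in> segment_ratios C x x S"
    using x by (auto simp: segment_ratios_def)
  then show "Inf (segment_ratios C x x S) \<le> 0"
    by (rule Inf_segment_ratios)
qed

section \<open>The error bound relative to the vertex distance\<close>

lemma argmins_nonempty:
  assumes "compact C" and "C \<noteq> {}" and "continuous_on C f"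
  shows "argmins C f \<noteq> {}"
proof -
  obtain z where z: "z \<in> C" "\<forall>x\<in>C. f z \<le> f x"
    using continuous_attains_inf[OF assms] by blast
  then have "min_val C f = f z"
    unfolding min_val_def by (intro cInf_eq_minimum) auto
  then show ?thesis
    using z by (auto simp: argmins_def)
qed

theorem proposition3p10:
  fixes N :: "real ^ 'n \<Rightarrow> real"
    and C U :: "(real ^ 'n) set"
    and f :: "real ^ 'n \<Rightarrow> real"
    and \<mu> \<theta> :: real
  assumes "is_norm N"
    and "polytope C" and "C \<noteq> {}"
    and "convex_on C f"
    and "open U" and "C \<subseteq> U" and "f differentiable_on U"
    and "\<mu> > 0" and "0 < \<theta>" and "\<theta> \<le> 1 / 2"
    and "holder_error_bound N \<mu> \<theta> C f"
  shows "error_bound_relative (vertex_distance C)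
           (\<mu> * inner_facial_distance N (min_face C (argmins C f)) C powr (1 / \<theta>)) \<theta> C f"
proof -
  let ?F = "min_face C (argmins C f)"
  let ?\<Phi> = "inner_facial_distance N ?F C"
  have compC: "compact C" and convC: "convex C"
    using assms(2) by (simp_all add: polytope_imp_compact polytope_imp_convex)
  have cont: "continuous_on C f"
    using assms(6,7) differentiable_imp_continuous_on continuous_on_subset by blast
  have ne: "argmins C f \<noteq> {}"
    by (rule argmins_nonempty[OF compC assms(3) cont])
  have sub: "argmins C f \<subseteq> C"
    by (auto simp: argmins_def)
  have F: "?F face_of C" and subF: "argmins C f \<subseteq> ?F"
    using min_face_face[OF convC sub ne] by (simp_all add: min_face_def hull_subset)
  have bound: "(INF y\<in>argmins C f. vertex_distance C y x)
      \<le> ((f x - min_val C f) / (\<mu> * ?\<Phi> powr (1 / \<theta>))) powr \<theta>" (is "?I \<le> _") if x: "x \<in> C" for x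
  proof -
    have bdd: "bdd_below ((\<lambda>y. vertex_distance C y x) ` argmins C f)"
      using vertex_distance_bounds[OF assms(2) _ x] sub by (intro bdd_belowI[of _ 0]) force
    show ?thesis
    proof (cases "\<exists>c. C = {c}")
      case True
      \<comment> \<open>Here the facial distance is unspecified, but the left-hand side vanishes.\<close>
      then obtain c where c: "C = {c}"
        by blast
      then have "c \<in> argmins C f" "x = c"
        using ne sub x by auto
      then have "?I \<le> 0"
        using cINF_lower[OF bdd, of c] vertex_distance_self_le[OF assms(2) x] by simp
      then show ?thesis
        by (rule order_trans) simp
    next
      case False
      then have pos: "0 < ?\<Phi>"
        using ne subF by (intro inner_facial_distance_pos[OF assms(1,2) F]) auto
      have "?\<Phi> * ?I \<le> (INF y\<in>argmins C f. N (y - x))"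
      proof (rule cINF_greatest[OF ne])
        fix y
        assume y: "y \<in> argmins C f"
        have "?I \<le> vertex_distance C y x"
          by (rule cINF_lower[OF bdd y])
        also have "\<dots> \<le> N (y - x) / ?\<Phi>"
          using y subF by (intro vertex_distance_le[OF assms(1,2) F _ x pos]) blast
        finally show "?\<Phi> * ?I \<le> N (y - x)"
          using pos by (simp add: pos_le_divide_eq mult.commute)
      qed
      also have "\<dots> \<le> ((f x - min_val C f) / \<mu>) powr \<theta>"
        using assms(11) x by (simp add: holder_error_bound_def)
      finally have "?I \<le> ((f x - min_val C f) / \<mu>) powr \<theta> / ?\<Phi>"
        using pos by (simp add: pos_le_divide_eq mult.commute)
      also have "\<dots> = ((f x - min_val C f) / \<mu>) powr \<theta> / (?\<Phi> powr (1 / \<theta>)) powr \<theta>"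
        using pos assms(9) by (simp add: powr_powr)
      also have "\<dots> = ((f x - min_val C f) / (\<mu> * ?\<Phi> powr (1 / \<theta>))) powr \<theta>"
      proof -
        have "bdd_below (f ` C)"
          using compact_continuous_image[OF cont compC]
          by (intro bounded_imp_bdd_below compact_imp_bounded)
        then have "0 \<le> f x - min_val C f"
          using x by (simp add: min_val_def cINF_lower)
        then show ?thesis
          using assms(8) by (simp flip: powr_divide)
      qed
      finally show ?thesis .
    qed
  qed
  show ?thesis
    unfolding error_bound_relative_def
    using vertex_distance_bounds[OF assms(2)] bound by blast
qed

end
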